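(* Let $A=[a_{ij}]\in\mathbb{R}^{n\times n}$, $n\ge 2$, be a matrix of the block form $$A=\begin{bmatrix} B & c\\ d^{T} & a_{nn}\end{bmatrix},$$ where $B$ is an upper triangular matrix of order $n-1$, $c\in\mathbb{R}^{n-1}$, $0\le d\in\mathbb{R}^{n-1}$, and $a_{nn}>0$. Then the following statements are equivalent: (i) $A\in\mathbf{Q}$. (ii) $A\in\mathbf{E}$. (iii) The diagonal of $A$ is positive. (iv) The diagonal of $A$ is nonnegative and $A\in\mathbf{R}_0$. (v) $A\in\mathbf{R}^*$.
   Context: For $A\in\mathbb{R}^{n\times n}$ and $q\in\mathbb{R}^n$, $\mathrm{LCP}(A,q)$ is the problem of finding $x\in\mathbb{R}^n$ with $x\ge 0$, $Ax+q\ge 0$ and $x^\top(Ax+q)=0$ (inequalities between vectors are componentwise; $d>0$ means all components of $d$ are positive). - $A\in\mathbf{Q}$ if $\mathrm{LCP}(A,q)$ has a solution for every $q\in\mathbb{R}^n$. - $A\in\mathbf{R}_0$ if $x=0$ is the only solution of $\mathrm{LCP}(A,0)$. - $A\in\mathbf{E}_0$ (respectively $A\in\mathbf{E}$) if for every $d>0$ (respectively every $d\ge 0$) in $\mathbb{R}^n$, $x=0$ is the only solution of $\mathrm{LCP}(A,d)$. - $A\in\mathbf{R}^*$ if $A\in\mathbf{R}_0$ and $A\in\mathbf{E}_0$. A square matrix is upper triangular if its entries below the main diagonal are all zero. *)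

theory Defs
  imports "Jordan_Normal_Form.Matrix"
begin

text \<open>The order on vectors is componentwise (it includes equality of dimensions). The library's
  strict order on vectors is \<open>v \<le> w \<and> \<not> w \<le> v\<close>, so componentwise positivity needs its own
  predicate.\<close>

definition pos_vec :: "real vec \<Rightarrow> bool" where
  "pos_vec v \<longleftrightarrow> (\<forall>i < dim_vec v. 0 < v $ i)"

definition LCP :: "real mat \<Rightarrow> real vec \<Rightarrow> real vec set" where
  "LCP A q = {x \<in> carrier_vec (dim_col A).
     0\<^sub>v (dim_col A) \<le> x \<and> 0\<^sub>v (dim_row A) \<le> A *\<^sub>v x + q \<and> x \<bullet> (A *\<^sub>v x + q) = 0}"

definition class_Q :: "nat \<Rightarrow> real mat set" where
  "class_Q n = {A \<in> carrier_mat n n. \<forall>q \<in> carrier_vec n. LCP A q \<noteq> {}}"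

definition class_R0 :: "nat \<Rightarrow> real mat set" where
  "class_R0 n = {A \<in> carrier_mat n n. LCP A (0\<^sub>v n) = {0\<^sub>v n}}"

definition class_E0 :: "nat \<Rightarrow> real mat set" where
  "class_E0 n = {A \<in> carrier_mat n n. \<forall>d \<in> carrier_vec n. pos_vec d \<longrightarrow> LCP A d = {0\<^sub>v n}}"

definition class_E :: "nat \<Rightarrow> real mat set" where
  "class_E n = {A \<in> carrier_mat n n. \<forall>d \<in> carrier_vec n. 0\<^sub>v n \<le> d \<longrightarrow> LCP A d = {0\<^sub>v n}}"

definition class_Rstar :: "nat \<Rightarrow> real mat set" where
  "class_Rstar n = class_R0 n \<inter> class_E0 n"

end

theory Submission
  imports Defs
begin

text \<open>In a bordered triangular matrix, a nonnegative last component of \<open>q\<close> forces \<open>x\<^sub>n = 0\<close>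
  (the last row is nonnegative with positive corner), and then a positive diagonal and nonnegative
  entries of \<open>q\<close> force the trailing components of \<open>x\<close> to vanish one after the other. This gives
  (iii) \<open>\<Longrightarrow>\<close> (ii), and also (i) \<open>\<Longrightarrow>\<close> (iii), since \<open>LCP(A, - e\<^sub>i)\<close> is unsolvable for the last \<open>i\<close>
  with \<open>a\<^sub>i\<^sub>i \<le> 0\<close>. For (iii) \<open>\<Longrightarrow>\<close> (i), back substitution expresses the other components as
  continuous functions of \<open>t = x\<^sub>n\<close>, and the intermediate value theorem finds \<open>t\<close> for the last
  row. If \<open>i\<close> is the first index with \<open>a\<^sub>i\<^sub>i = 0\<close>, back substitution on the leading block extends
  \<open>x\<^sub>i = 1\<close> to a nonzero solution of \<open>LCP(A, 0)\<close>, so (iv) \<open>\<Longrightarrow>\<close> (iii). The remaining implications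
  come from testing with unit vectors.\<close>

section \<open>Componentwise form of the complementarity problem\<close>

lemma mem_LCP_iff:
  assumes A: "A \<in> carrier_mat n n" and q: "q \<in> carrier_vec n"
  shows "x \<in> LCP A q \<longleftrightarrow> x \<in> carrier_vec n \<and>
    (\<forall>i<n. 0 \<le> x $ i \<and> 0 \<le> (\<Sum>j<n. A $$ (i, j) * x $ j) + q $ i \<and>
           x $ i * ((\<Sum>j<n. A $$ (i, j) * x $ j) + q $ i) = 0)"
proof (cases "x \<in> carrier_vec n")
  case True
  define w where "w i = (\<Sum>j<n. A $$ (i, j) * x $ j) + q $ i" for i
  have nth: "(A *\<^sub>v x + q) $ i = w i" if "i < n" for i
    using that A q True by (auto simp: scalar_prod_def w_def atLeast0LessThan intro!: sum.cong)
  have dims: "dim_row A = n" "dim_col A = n" "dim_vec x = n" "dim_vec (A *\<^sub>v x + q) = n"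
    using A q True by auto
  have prod: "x \<bullet> (A *\<^sub>v x + q) = (\<Sum>i<n. x $ i * w i)"
    unfolding scalar_prod_def dims atLeast0LessThan by (intro sum.cong) (auto simp: nth)
  have w_nonneg: "0\<^sub>v n \<le> A *\<^sub>v x + q \<longleftrightarrow> (\<forall>i<n. 0 \<le> w i)"
    by (simp add: less_eq_vec_def dims nth del: index_add_vec)
  have x_nonneg: "0\<^sub>v n \<le> x \<longleftrightarrow> (\<forall>i<n. 0 \<le> x $ i)"
    by (simp add: less_eq_vec_def dims)
  have "x \<in> LCP A q \<longleftrightarrow> (\<forall>i<n. 0 \<le> x $ i) \<and> (\<forall>i<n. 0 \<le> w i) \<and> (\<Sum>i<n. x $ i * w i) = 0"
    using True unfolding LCP_def dims by (simp only: mem_Collect_eq x_nonneg w_nonneg prod simp_thms)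
  \<comment> \<open>All summands are products of nonnegative numbers, so the inner product vanishes
    only if each of them does.\<close>
  also have "\<dots> \<longleftrightarrow> (\<forall>i<n. 0 \<le> x $ i \<and> 0 \<le> w i \<and> x $ i * w i = 0)"
  proof -
    have "(\<Sum>i<n. x $ i * w i) = 0 \<longleftrightarrow> (\<forall>i<n. x $ i * w i = 0)"
      if "\<forall>i<n. 0 \<le> x $ i" "\<forall>i<n. 0 \<le> w i"
      using that by (subst sum_nonneg_eq_0_iff) auto
    then show ?thesis by blast
  qed
  finally show ?thesis using True unfolding w_def by simp
next
  case False
  then show ?thesis using A by (auto simp: LCP_def)
qed

lemma mem_LCP_I:
  assumes "A \<in> carrier_mat n n" and "q \<in> carrier_vec n"
    and "\<And>i. i < n \<Longrightarrow> 0 \<le> x i"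
    and "\<And>i. i < n \<Longrightarrow> 0 \<le> (\<Sum>j<n. A $$ (i, j) * x j) + q $ i"
    and "\<And>i. i < n \<Longrightarrow> x i = 0 \<or> (\<Sum>j<n. A $$ (i, j) * x j) + q $ i = 0"
  shows "vec n x \<in> LCP A q"
  using assms by (auto simp: mem_LCP_iff)

section \<open>Unit vectors as tests for the diagonal\<close>

text \<open>For x = e_i the product A x is column i, and complementarity concerns row i alone.
  Choosing \<open>q\<close> to fit this column gives a nonzero solution, which refutes
  uniqueness.\<close>

lemma unit_vec_mem_LCP:
  assumes A: "A \<in> carrier_mat n n" and q: "q \<in> carrier_vec n" and i: "i < n"
    and "q $ i = - A $$ (i, i)"
    and "\<And>j. j < n \<Longrightarrow> 0 \<le> A $$ (j, i) + q $ j"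
  shows "unit_vec n i \<in> LCP A q"
proof -
  have "(\<Sum>k<n. A $$ (j, k) * (if k = i then 1 else 0)) = A $$ (j, i)" for j
    using i by (simp add: if_distrib cong: if_cong)
  then have "vec n (\<lambda>k. if k = i then 1 else 0) \<in> LCP A q"
    using assms by (intro mem_LCP_I) auto
  then show ?thesis by (simp add: unit_vec_def)
qed

lemma zero_mem_LCP:
  assumes "A \<in> carrier_mat n n" and "q \<in> carrier_vec n" and "\<And>i. i < n \<Longrightarrow> 0 \<le> q $ i"
  shows "0\<^sub>v n \<in> LCP A q"
  using assms by (simp add: mem_LCP_iff)

lemma class_E_diag_pos:
  assumes "A \<in> class_E n" and i: "i < n"
  shows "0 < A $$ (i, i)"
proof (rule ccontr)
  assume neg: "\<not> 0 < A $$ (i, i)"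
  \<comment> \<open>The entry at \<open>i\<close> cancels the diagonal and is nonnegative by
    \<open>neg\<close>; the absolute values outweigh the rest of column \<open>i\<close>.\<close>
  define q where "q = vec n (\<lambda>j. if j = i then - A $$ (i, i) else \<bar>A $$ (j, i)\<bar>)"
  have A: "A \<in> carrier_mat n n" and q: "q \<in> carrier_vec n"
    using assms by (auto simp: class_E_def q_def)
  have "0\<^sub>v n \<le> q"
    using neg by (auto simp: q_def less_eq_vec_def)
  then have "LCP A q = {0\<^sub>v n}"
    using assms q by (auto simp: class_E_def)
  moreover have "unit_vec n i \<in> LCP A q"
    using i by (intro unit_vec_mem_LCP A q) (auto simp: q_def)
  ultimately have "unit_vec n i = (0\<^sub>v n :: real vec)" by simp
  then show False using i by (metis index_unit_vec(2) index_zero_vec(1) zero_neq_one)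
qed

lemma class_E0_diag_nonneg:
  assumes "A \<in> class_E0 n" and i: "i < n"
  shows "0 \<le> A $$ (i, i)"
proof (rule ccontr)
  assume neg: "\<not> 0 \<le> A $$ (i, i)"
  \<comment> \<open>The extra 1 makes \<open>q\<close> strictly positive off \<open>i\<close>. At
    \<open>i\<close> strictness needs a negative diagonal entry, so only nonnegativity of the
    diagonal results.\<close>
  define q where "q = vec n (\<lambda>j. if j = i then - A $$ (i, i) else 1 + \<bar>A $$ (j, i)\<bar>)"
  have A: "A \<in> carrier_mat n n" and q: "q \<in> carrier_vec n"
    using assms by (auto simp: class_E0_def q_def)
  have "pos_vec q"
    using neg by (auto simp: q_def pos_vec_def)
  then have "LCP A q = {0\<^sub>v n}"
    using assms q by (auto simp: class_E0_def)
  moreover have "unit_vec n i \<in> LCP A q"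
    using i by (intro unit_vec_mem_LCP A q) (auto simp: q_def)
  ultimately have "unit_vec n i = (0\<^sub>v n :: real vec)" by simp
  then show False using i by (metis index_unit_vec(2) index_zero_vec(1) zero_neq_one)
qed

lemma class_E_subset_class_Rstar: "class_E n \<subseteq> class_Rstar n"
proof
  fix A assume A: "A \<in> class_E n"
  have "LCP A (0\<^sub>v n) = {0\<^sub>v n}"
    using A by (simp add: class_E_def)
  moreover have "0\<^sub>v n \<le> d" if "d \<in> carrier_vec n" "pos_vec d" for d
    using that by (auto simp: pos_vec_def less_eq_vec_def intro: less_imp_le)
  ultimately show "A \<in> class_Rstar n"
    using A by (auto simp: class_E_def class_Rstar_def class_R0_def class_E0_def)
qed

section \<open>Back substitution with a parameter\<close>

text \<open>Once the later components are known, row \<open>i\<close> is a scalar complementarity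
  problem with positive slope \<open>b i i\<close>, whose solution depends continuously on the data.
  The parameter \<open>t\<close> will stand for the border variable.\<close>

lemma triangular_complementarity_continuous:
  fixes b :: "nat \<Rightarrow> nat \<Rightarrow> real" and r :: "nat \<Rightarrow> 'a::topological_space \<Rightarrow> real"
  assumes "\<And>i. i < k \<Longrightarrow> 0 < b i i" and "\<And>i. continuous_on UNIV (r i)"
  obtains x where "\<And>i. continuous_on UNIV (x i)"
    and "\<And>i t. i < k \<Longrightarrow> 0 \<le> x i t"
    and "\<And>i t. i < k \<Longrightarrow> 0 \<le> (\<Sum>j\<in>{i..<k}. b i j * x j t) + r i t"
    and "\<And>i t. i < k \<Longrightarrow> x i t = 0 \<or> (\<Sum>j\<in>{i..<k}. b i j * x j t) + r i t = 0"
  using assms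
proof (induction k arbitrary: r thesis)
  case 0
  show ?case by (rule "0.prems"(1)[of "\<lambda>_ _. 0"]) auto
next
  case (Suc k)
  \<comment> \<open>This solves the last row, where only the diagonal term is left.\<close>
  define y where "y t = max 0 (- r k t / b k k)" for t
  have bk: "0 < b k k" using Suc.prems(2) by simp
  have cont_y: "continuous_on UNIV y"
    unfolding y_def using bk Suc.prems(3) by (intro continuous_intros) auto
  have cont: "continuous_on UNIV (\<lambda>t. r i t + b i k * y t)" for i
    using cont_y Suc.prems(3) by (intro continuous_intros) auto
  \<comment> \<open>The contribution of the solved component \<open>y\<close> moves into the
    right-hand side, which is why the induction generalizes over \<open>r\<close>.\<close>
  obtain x where x: "\<And>i. continuous_on UNIV (x i)"
    "\<And>i t. i < k \<Longrightarrow> 0 \<le> x i t"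
    "\<And>i t. i < k \<Longrightarrow> 0 \<le> (\<Sum>j\<in>{i..<k}. b i j * x j t) + (r i t + b i k * y t)"
    "\<And>i t. i < k \<Longrightarrow> x i t = 0 \<or>
        (\<Sum>j\<in>{i..<k}. b i j * x j t) + (r i t + b i k * y t) = 0"
    by (rule Suc.IH[where r = "\<lambda>i t. r i t + b i k * y t"]) (use Suc.prems(2) cont in auto)
  define z where "z = x(k := y)"
  have last: "0 \<le> y t \<and> 0 \<le> b k k * y t + r k t \<and> (y t = 0 \<or> b k k * y t + r k t = 0)" for t
    using bk by (auto simp: y_def max_def field_simps)
  have sum: "(\<Sum>j\<in>{i..<Suc k}. b i j * z j t) = (\<Sum>j\<in>{i..<k}. b i j * x j t) + b i k * y t"
    if "i \<le> k" for i t
    using that by (simp add: z_def)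
  show ?case
  proof (rule Suc.prems(1)[of z])
    fix i show "continuous_on UNIV (z i)"
      using x(1) cont_y by (simp add: z_def)
  next
    fix i t assume "i < Suc k"
    then consider "i < k" | "i = k" by linarith
    then have "0 \<le> z i t \<and> 0 \<le> (\<Sum>j\<in>{i..<Suc k}. b i j * z j t) + r i t \<and>
      (z i t = 0 \<or> (\<Sum>j\<in>{i..<Suc k}. b i j * z j t) + r i t = 0)"
    proof cases
      case 1
      then have "z i t = x i t" by (simp add: z_def)
      then show ?thesis
        using x(2-4)[OF 1, of t] 1 sum[of i t] by (simp add: algebra_simps)
    next
      case 2
      then show ?thesis using last[of t] sum[of k t] by (simp add: z_def)
    qed
    then show "0 \<le> z i t" "0 \<le> (\<Sum>j\<in>{i..<Suc k}. b i j * z j t) + r i t"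
      "z i t = 0 \<or> (\<Sum>j\<in>{i..<Suc k}. b i j * z j t) + r i t = 0"
      by blast+
  qed
qed

section \<open>Bordered triangular matrices\<close>

locale bordered_triangular =
  fixes A :: "real mat" and m :: nat
  assumes carrier: "A \<in> carrier_mat (Suc m) (Suc m)"
    and lower_zero: "j < i \<Longrightarrow> i < m \<Longrightarrow> A $$ (i, j) = 0"
    and last_row_nonneg: "j < m \<Longrightarrow> 0 \<le> A $$ (m, j)"
    and corner_pos: "0 < A $$ (m, m)"
begin

lemma row_sum:
  assumes "i < m"
  shows "(\<Sum>j<Suc m. A $$ (i, j) * x j) = (\<Sum>j\<in>{i..<m}. A $$ (i, j) * x j) + A $$ (i, m) * x m"
proof -
  have "(\<Sum>j<m. A $$ (i, j) * x j) = (\<Sum>j\<in>{i..<m}. A $$ (i, j) * x j)"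
    using assms lower_zero by (intro sum.mono_neutral_right) auto
  then show ?thesis by simp
qed

text \<open>Induction runs downwards from \<open>m\<close>. The cut-off \<open>k\<close> allows an
  arbitrary diagonal and arbitrary entries of \<open>q\<close> before it.\<close>

lemma LCP_trailing_zero:
  assumes x: "x \<in> LCP A q" and q: "q \<in> carrier_vec (Suc m)"
    and pos: "\<And>j. k \<le> j \<Longrightarrow> j \<le> m \<Longrightarrow> 0 \<le> q $ j \<and> 0 < A $$ (j, j)"
  shows "k \<le> i \<Longrightarrow> i \<le> m \<Longrightarrow> x $ i = 0"
proof (induction "m - i" arbitrary: i rule: less_induct)
  case less
  define w where "w = (\<Sum>j<Suc m. A $$ (i, j) * x $ j) + q $ i"
  have nonneg: "0 \<le> x $ j" if "j \<le> m" for j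
    using x that by (simp add: mem_LCP_iff[OF carrier q])
  have compl: "x $ i * w = 0"
    using x less.prems unfolding w_def by (simp add: mem_LCP_iff[OF carrier q] del: sum.lessThan_Suc)
  \<comment> \<open>This bound suffices: a positive \<open>x $ i\<close> would make \<open>w\<close>
    positive, against complementarity.\<close>
  have "A $$ (i, i) * x $ i \<le> w"
  proof (cases "i = m")
    case True
    have "0 \<le> (\<Sum>j<m. A $$ (m, j) * x $ j)"
      by (intro sum_nonneg mult_nonneg_nonneg) (auto simp: last_row_nonneg nonneg)
    then show ?thesis using True pos[of m] less.prems by (simp add: w_def)
  next
    case False
    then have i: "i < m" using less.prems by simp
    have zero: "x $ j = 0" if "i < j" "j \<le> m" for j
      using less.hyps[of j] that less.prems by simp
    have "(\<Sum>j\<in>{i..<m}. A $$ (i, j) * x $ j) = A $$ (i, i) * x $ i"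
      using i zero by (subst sum.atLeast_Suc_lessThan) auto
    then have "w = A $$ (i, i) * x $ i + q $ i"
      using zero[of m] i by (simp add: w_def row_sum[OF i] del: sum.lessThan_Suc)
    then show ?thesis using pos[of i] less.prems by simp
  qed
  moreover have "0 < A $$ (i, i)" using pos less.prems by blast
  ultimately show "x $ i = 0"
    using compl nonneg[OF less.prems(2)]
    by (metis mult_eq_0_iff mult_pos_pos not_less order_le_less)
qed

lemma diag_pos_imp_class_E:
  assumes pos: "\<And>i. i \<le> m \<Longrightarrow> 0 < A $$ (i, i)"
  shows "A \<in> class_E (Suc m)"
proof -
  have "LCP A q = {0\<^sub>v (Suc m)}" if q: "q \<in> carrier_vec (Suc m)" and "0\<^sub>v (Suc m) \<le> q" for q
  proof -
    have q_nonneg: "0 \<le> q $ i" if "i < Suc m" for i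
      using \<open>0\<^sub>v (Suc m) \<le> q\<close> q that by (auto simp: less_eq_vec_def)
    have "x = 0\<^sub>v (Suc m)" if x: "x \<in> LCP A q" for x
    proof (rule eq_vecI)
      show "dim_vec x = dim_vec (0\<^sub>v (Suc m))"
        using x by (simp add: mem_LCP_iff[OF carrier q])
      fix i assume "i < dim_vec (0\<^sub>v (Suc m) :: real vec)"
      then show "x $ i = 0\<^sub>v (Suc m) $ i"
        using LCP_trailing_zero[OF x q, of 0 i] pos q_nonneg by simp
    qed
    then show ?thesis
      using zero_mem_LCP[OF carrier q q_nonneg] by blast
  qed
  then show ?thesis using carrier by (simp add: class_E_def)
qed

lemma diag_pos_imp_class_Q:
  assumes pos: "\<And>i. i \<le> m \<Longrightarrow> 0 < A $$ (i, i)"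
  shows "A \<in> class_Q (Suc m)"
proof -
  have "LCP A q \<noteq> {}" if q: "q \<in> carrier_vec (Suc m)" for q
  proof -
    obtain x where x: "\<And>i. continuous_on UNIV (x i)"
      "\<And>i t. i < m \<Longrightarrow> 0 \<le> x i t"
      "\<And>i t. i < m \<Longrightarrow> 0 \<le> (\<Sum>j\<in>{i..<m}. A $$ (i, j) * x j t) + (A $$ (i, m) * t + q $ i)"
      "\<And>i t. i < m \<Longrightarrow>
        x i t = 0 \<or> (\<Sum>j\<in>{i..<m}. A $$ (i, j) * x j t) + (A $$ (i, m) * t + q $ i) = 0"
      by (rule triangular_complementarity_continuous
          [where b = "\<lambda>i j. A $$ (i, j)" and r = "\<lambda>i t. A $$ (i, m) * t + q $ i" and k = m])
        (use pos in \<open>auto intro!: continuous_intros\<close>)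
    \<comment> \<open>The slack of the last row when the border variable is \<open>t\<close> and the
      others come from back substitution; a scalar complementarity problem in \<open>t\<close>
      remains.\<close>
    define f where "f t = (\<Sum>j<m. A $$ (m, j) * x j t) + A $$ (m, m) * t + q $ m" for t
    have "\<exists>t\<ge>0. 0 \<le> f t \<and> (t = 0 \<or> f t = 0)"
    proof (cases "0 \<le> f 0")
      case False
      \<comment> \<open>At \<open>T\<close> the corner term equals the absolute value of
        \<open>q $ m\<close>, and the other terms of the row are nonnegative, so \<open>f\<close>
        changes sign on the interval from 0 to \<open>T\<close>.\<close>
      define T where "T = \<bar>q $ m\<bar> / A $$ (m, m)"
      have "0 \<le> T" using corner_pos by (simp add: T_def)
      moreover have "0 \<le> f T"
      proof -
        have "0 \<le> (\<Sum>j<m. A $$ (m, j) * x j T)"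
          using last_row_nonneg x(2) by (intro sum_nonneg mult_nonneg_nonneg) auto
        moreover have "A $$ (m, m) * T = \<bar>q $ m\<bar>"
          using corner_pos by (simp add: T_def)
        ultimately show ?thesis by (simp add: f_def)
      qed
      moreover have "continuous_on {0..T} f"
        unfolding f_def by (intro continuous_intros continuous_on_subset[OF x(1)]) auto
      ultimately obtain t where "0 \<le> t" "f t = 0"
        using IVT'[of f 0 0 T] False by auto
      then show ?thesis by auto
    qed auto
    then obtain t where t: "0 \<le> t" "0 \<le> f t" "t = 0 \<or> f t = 0" by blast
    define z where "z i = (if i = m then t else x i t)" for i
    have "(\<Sum>j\<in>{i..<m}. A $$ (i, j) * z j) = (\<Sum>j\<in>{i..<m}. A $$ (i, j) * x j t)" for i
      by (intro sum.cong) (auto simp: z_def)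
    then have row: "(\<Sum>j<Suc m. A $$ (i, j) * z j) + q $ i
        = (\<Sum>j\<in>{i..<m}. A $$ (i, j) * x j t) + (A $$ (i, m) * t + q $ i)" if "i < m" for i
      by (simp add: row_sum[OF that] z_def del: sum.lessThan_Suc)
    have last: "(\<Sum>j<Suc m. A $$ (m, j) * z j) + q $ m = f t"
      by (auto simp: f_def z_def intro!: sum.cong)
    have "0 \<le> z i \<and> 0 \<le> (\<Sum>j<Suc m. A $$ (i, j) * z j) + q $ i \<and>
        (z i = 0 \<or> (\<Sum>j<Suc m. A $$ (i, j) * z j) + q $ i = 0)" if "i < Suc m" for i
    proof (cases "i = m")
      case True
      then show ?thesis using t last by (simp add: z_def del: sum.lessThan_Suc)
    next
      case False
      then have "i < m" using that by simp
      then show ?thesis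
        unfolding row[OF \<open>i < m\<close>] using x(2-4)[of i t] by (simp add: z_def)
    qed
    then have "vec (Suc m) z \<in> LCP A q"
      by (intro mem_LCP_I carrier q) blast+
    then show ?thesis by blast
  qed
  then show ?thesis using carrier by (simp add: class_Q_def)
qed

lemma class_Q_imp_diag_pos:
  assumes Q: "A \<in> class_Q (Suc m)" and "k \<le> m"
  shows "0 < A $$ (k, k)"
proof (rule ccontr)
  assume neg: "\<not> 0 < A $$ (k, k)"
  define S where "S = {i. i \<le> m \<and> \<not> 0 < A $$ (i, i)}"
  have S: "finite S" "S \<noteq> {}" using neg \<open>k \<le> m\<close> by (auto simp: S_def)
  define i where "i = Max S"
  have "i \<in> S" using S by (simp add: i_def)
  then have i: "i < m" "A $$ (i, i) \<le> 0"
    using corner_pos by (auto simp: S_def order_le_less)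
  have above: "0 < A $$ (j, j)" if "i < j" "j \<le> m" for j
    using that Max_ge[OF S(1), of j] by (fastforce simp: S_def i_def)
  \<comment> \<open>Beyond \<open>i\<close> this \<open>q\<close> is zero and the diagonal is
    positive, so the trailing components of any solution vanish. Row \<open>i\<close> then demands
    a_ii x_i \<ge> 1, which is impossible.\<close>
  define q where "q = vec (Suc m) (\<lambda>j. if j = i then - 1 else 0 :: real)"
  have q: "q \<in> carrier_vec (Suc m)" by (simp add: q_def)
  obtain x where x: "x \<in> LCP A q"
    using Q q by (auto simp: class_Q_def)
  have zero: "x $ j = 0" if "i < j" "j \<le> m" for j
    using LCP_trailing_zero[OF x q, of "Suc i" j] above that by (auto simp: q_def)
  have "(\<Sum>j\<in>{i..<m}. A $$ (i, j) * x $ j) = A $$ (i, i) * x $ i"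
    using i zero by (subst sum.atLeast_Suc_lessThan) auto
  then have "(\<Sum>j<Suc m. A $$ (i, j) * x $ j) = A $$ (i, i) * x $ i"
    using zero[of m] i(1) by (simp add: row_sum[OF i(1)] del: sum.lessThan_Suc)
  moreover have "0 \<le> (\<Sum>j<Suc m. A $$ (i, j) * x $ j) + q $ i" and "0 \<le> x $ i"
    using x i(1) by (simp_all add: mem_LCP_iff[OF carrier q] del: sum.lessThan_Suc)
  ultimately show False
    using i mult_nonpos_nonneg[of "A $$ (i, i)" "x $ i"] by (simp add: q_def)
qed

lemma class_R0_imp_diag_pos:
  assumes R0: "A \<in> class_R0 (Suc m)" and nonneg: "\<And>i. i \<le> m \<Longrightarrow> 0 \<le> A $$ (i, i)"
    and "k \<le> m"
  shows "0 < A $$ (k, k)"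
proof (rule ccontr)
  assume "\<not> 0 < A $$ (k, k)"
  then have k: "k \<le> m \<and> A $$ (k, k) = 0"
    using nonneg[OF \<open>k \<le> m\<close>] \<open>k \<le> m\<close> by simp
  define i where "i = (LEAST i. i \<le> m \<and> A $$ (i, i) = 0)"
  have "i \<le> m \<and> A $$ (i, i) = 0"
    unfolding i_def using k by (rule LeastI)
  then have i: "i < m" "A $$ (i, i) = 0"
    using corner_pos by (auto simp: order_le_less)
  have below: "0 < A $$ (j, j)" if "j < i" for j
    using not_less_Least[OF that[unfolded i_def]] nonneg[of j] that i(1)
    by (auto simp: order_le_less)
  \<comment> \<open>Here the right-hand side is the constant column \<open>i\<close>, so the
    parameter is a dummy, later set to 0.\<close>
  obtain x :: "nat \<Rightarrow> real \<Rightarrow> real" where x: "\<And>j t. j < i \<Longrightarrow> 0 \<le> x j t"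
    "\<And>j t. j < i \<Longrightarrow> 0 \<le> (\<Sum>l\<in>{j..<i}. A $$ (j, l) * x l t) + A $$ (j, i)"
    "\<And>j t. j < i \<Longrightarrow> x j t = 0 \<or> (\<Sum>l\<in>{j..<i}. A $$ (j, l) * x l t) + A $$ (j, i) = 0"
    by (rule triangular_complementarity_continuous
        [where b = "\<lambda>j l. A $$ (j, l)" and r = "\<lambda>j t. A $$ (j, i)" and k = i])
      (use below in auto)
  \<comment> \<open>Row \<open>i\<close> has zero slack because its diagonal entry is 0. Rows
    strictly between \<open>i\<close> and \<open>m\<close> vanish by triangularity, and the last row
    is nonnegative with \<open>z m = 0\<close>.\<close>
  define z where "z j = (if j < i then x j 0 else if j = i then 1 else 0)" for j
  have z_nonneg: "0 \<le> z j" for j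
    using x(1) by (simp add: z_def)
  have row: "(\<Sum>l<Suc m. A $$ (j, l) * z l) = (\<Sum>l\<in>{j..<i}. A $$ (j, l) * x l 0) + A $$ (j, i)"
    if "j \<le> i" for j
  proof -
    have "(\<Sum>l<Suc m. A $$ (j, l) * z l) = (\<Sum>l\<in>{j..<m}. A $$ (j, l) * z l)"
      using i(1) that by (subst row_sum) (auto simp: z_def)
    also have "\<dots> = (\<Sum>l\<in>{j..<Suc i}. A $$ (j, l) * z l)"
      using i(1) by (intro sum.mono_neutral_right) (auto simp: z_def)
    also have "\<dots> = (\<Sum>l\<in>{j..<i}. A $$ (j, l) * z l) + A $$ (j, i)"
      using that by (simp add: z_def)
    also have "(\<Sum>l\<in>{j..<i}. A $$ (j, l) * z l) = (\<Sum>l\<in>{j..<i}. A $$ (j, l) * x l 0)"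
      by (intro sum.cong) (auto simp: z_def)
    finally show ?thesis .
  qed
  have "0 \<le> (\<Sum>l<Suc m. A $$ (j, l) * z l) \<and> (z j = 0 \<or> (\<Sum>l<Suc m. A $$ (j, l) * z l) = 0)"
    if "j < Suc m" for j
  proof -
    consider "j < i" | "j = i" | "i < j" "j < m" | "j = m"
      using \<open>j < Suc m\<close> by linarith
    then show ?thesis
    proof cases
      case 1
      then show ?thesis unfolding row[OF less_imp_le[OF 1]] using x[of j 0] by (simp add: z_def)
    next
      case 2
      then show ?thesis using row[of i] i(2) by (simp del: sum.lessThan_Suc)
    next
      case 3
      have "(\<Sum>l<Suc m. A $$ (j, l) * z l) = 0"
        using 3 i(1) by (subst row_sum) (auto simp: z_def)
      then show ?thesis by simp
    next
      case 4
      have "0 \<le> A $$ (m, l)" if "l < Suc m" for l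
        using that last_row_nonneg[of l] corner_pos by (cases "l = m") auto
      then have "0 \<le> (\<Sum>l<Suc m. A $$ (m, l) * z l)"
        using z_nonneg by (intro sum_nonneg mult_nonneg_nonneg) auto
      then show ?thesis using 4 i(1) by (simp add: z_def)
    qed
  qed
  then have "vec (Suc m) z \<in> LCP A (0\<^sub>v (Suc m))"
    using z_nonneg by (intro mem_LCP_I carrier) (auto simp del: sum.lessThan_Suc)
  then have "vec (Suc m) z = 0\<^sub>v (Suc m)"
    using R0 by (auto simp: class_R0_def)
  then have "vec (Suc m) z $ i = 0\<^sub>v (Suc m) $ i" by simp
  then show False using i(1) by (simp add: z_def)
qed

end

theorem theorem3p2:
  fixes n :: nat and A B :: "real mat" and c d :: "real vec" and ann :: real
  assumes "n \<ge> 2"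
    and "A = four_block_mat B (mat_of_cols (n - 1) [c])
                            (mat_of_row d) (mat 1 1 (\<lambda>_. ann))"
    and "B \<in> carrier_mat (n - 1) (n - 1)" and "upper_triangular B"
    and "c \<in> carrier_vec (n - 1)"
    and "d \<in> carrier_vec (n - 1)" and "0\<^sub>v (n - 1) \<le> d"
    and "ann > 0"
  shows "(A \<in> class_Q n \<longleftrightarrow> A \<in> class_E n)
       \<and> (A \<in> class_E n \<longleftrightarrow> (\<forall>i<n. 0 < A $$ (i, i)))
       \<and> ((\<forall>i<n. 0 < A $$ (i, i)) \<longleftrightarrow> (\<forall>i<n. 0 \<le> A $$ (i, i)) \<and> A \<in> class_R0 n)
       \<and> ((\<forall>i<n. 0 \<le> A $$ (i, i)) \<and> A \<in> class_R0 n \<longleftrightarrow> A \<in> class_Rstar n)"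
proof -
  obtain m where n: "n = Suc m" using \<open>n \<ge> 2\<close> by (cases n) auto
  note block = assms(2-8)[unfolded n diff_Suc_1]
  interpret bordered_triangular A m
  proof
    show "A \<in> carrier_mat (Suc m) (Suc m)"
      using block by auto
    show "A $$ (i, j) = 0" if "j < i" "i < m" for i j
      using block that by (auto simp: upper_triangular_def)
    show "0 \<le> A $$ (m, j)" if "j < m" for j
      using block that by (auto simp: mat_of_row_def less_eq_vec_def)
    show "0 < A $$ (m, m)"
      using block by auto
  qed
  \<comment> \<open>Statements (i) and (ii) are each compared with (iii). The cycle from (iii) to
    (v) by way of (ii), then to (iv) and back to (iii) covers the rest.\<close>
  have "A \<in> class_Q n \<longleftrightarrow> (\<forall>i<n. 0 < A $$ (i, i))"
    using class_Q_imp_diag_pos diag_pos_imp_class_Q unfolding n less_Suc_eq_le by blast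
  moreover have E: "A \<in> class_E n \<longleftrightarrow> (\<forall>i<n. 0 < A $$ (i, i))"
    using class_E_diag_pos diag_pos_imp_class_E unfolding n less_Suc_eq_le by fastforce
  moreover have "\<forall>i<n. 0 < A $$ (i, i)" if "\<forall>i<n. 0 \<le> A $$ (i, i)" "A \<in> class_R0 n"
    using class_R0_imp_diag_pos that unfolding n less_Suc_eq_le by blast
  moreover have "A \<in> class_Rstar n" if "\<forall>i<n. 0 < A $$ (i, i)"
    using class_E_subset_class_Rstar E that by blast
  moreover have "A \<in> class_R0 n" "\<forall>i<n. 0 \<le> A $$ (i, i)" if "A \<in> class_Rstar n"
    using that class_E0_diag_nonneg by (auto simp: class_Rstar_def)
  ultimately show ?thesis by (meson less_imp_le)
qed

end
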